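(* If Assumptions 1 and 2 (stated in the context) are satisfied, then the solution set $X^*$ is a singleton.
   Context: Primal problem: minimize $p(x):=f(x)+\sum_{i=1}^p g_i(A_i^Tx)$ over $x\in\mathbb R^n$; $X^*$ denotes its set of optimal solutions. Assumption 1: (i) $f:\mathbb R^n\to\mathbb R$ is convex and continuously differentiable, with gradient Lipschitz continuous with constant $L_f$; (ii) each $g_i:\mathbb R^{m_i}\to(-\infty,+\infty]$, $i=1,\dots,p$, is proper, lower semicontinuous and convex; (iii) the linear mappings $A_i:\mathbb R^{m_i}\to\mathbb R^n$, $i=1,\dots,p$, are full rank, that is, $\lambda_{\min}(A_i^TA_i)>0$; (iv) $X^*\neq\emptyset$. Assumption 2: $f$ is pointwise quadratically supportable at each $\hat x\in X^*$, i.e. for each $\hat x\in X^*$ there exist $\mu>0$ and a convex neighborhood $V$ of $\hat x$ with $f(x)\ge f(\hat x)+\langle\nabla f(\hat x),x-\hat x\rangle+\frac{\mu}{2}\|x-\hat x\|^2$ for all $x\in V$. *)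

theory Defs
  imports "HOL-Analysis.Analysis"
begin

text \<open>
  The spaces \<open>R^{m_i}\<close> have dimensions that vary with \<open>i\<close>. They are realised as
  coordinate spaces: for a nonempty finite index set \<open>J\<close> of size \<open>m\<close>, \<open>R^m\<close> is the
  space of vectors over an index type containing \<open>J\<close> that vanish outside \<open>J\<close>.
  The index type is arbitrary, so every finite family of positive dimensions occurs.
  Inner product and topology are the Euclidean ones.
\<close>

definition coord_space :: "'m::finite set \<Rightarrow> (real ^ 'm) set" where
  "coord_space J = {y. \<forall>j. j \<notin> J \<longrightarrow> y $ j = 0}"

text \<open>
  A linear map from \<open>R^J\<close> to \<open>R^n\<close> is given by its matrix, padded by zero columns outside
  \<open>J\<close>. The transpose of a padded matrix then maps \<open>R^n\<close> into \<open>R^J\<close> and represents the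
  transposed map.
\<close>

definition matrix_on :: "'m::finite set \<Rightarrow> real ^ 'm ^ 'n \<Rightarrow> bool" where
  "matrix_on J A \<longleftrightarrow> (\<forall>r c. c \<notin> J \<longrightarrow> A $ r $ c = 0)"

text \<open>
  Eigenvectors are taken in \<open>R^J\<close> only, so that the zero padding contributes no spurious
  eigenvalue 0. For nonempty \<open>J\<close> and symmetric \<open>B\<close> preserving \<open>R^J\<close> the set of
  eigenvalues is finite and nonempty.
\<close>

definition lambda_min :: "'m::finite set \<Rightarrow> real ^ 'm ^ 'm \<Rightarrow> real" where
  "lambda_min J B = Min {c. \<exists>v \<in> coord_space J. v \<noteq> 0 \<and> B *v v = c *\<^sub>R v}"

definition proper_on :: "'a set \<Rightarrow> ('a \<Rightarrow> ereal) \<Rightarrow> bool" where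
  "proper_on S g \<longleftrightarrow> (\<forall>y\<in>S. g y \<noteq> -\<infinity>) \<and> (\<exists>y\<in>S. g y \<noteq> \<infinity>)"

definition lsc_on :: "'a::topological_space set \<Rightarrow> ('a \<Rightarrow> ereal) \<Rightarrow> bool" where
  "lsc_on S g \<longleftrightarrow> (\<forall>y\<in>S. g y \<le> Liminf (at y within S) g)"

definition ereal_convex_on :: "'a::real_vector set \<Rightarrow> ('a \<Rightarrow> ereal) \<Rightarrow> bool" where
  "ereal_convex_on S g \<longleftrightarrow> convex S \<and>
     (\<forall>y\<in>S. \<forall>z\<in>S. \<forall>t::real. 0 < t \<and> t < 1 \<longrightarrow>
        g ((1 - t) *\<^sub>R y + t *\<^sub>R z) \<le> ereal (1 - t) * g y + ereal t * g z)"

definition primal_objective ::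
  "(real ^ 'n \<Rightarrow> real) \<Rightarrow> nat \<Rightarrow> (nat \<Rightarrow> real ^ 'm \<Rightarrow> ereal) \<Rightarrow> (nat \<Rightarrow> real ^ 'm ^ 'n)
    \<Rightarrow> real ^ 'n \<Rightarrow> ereal" where
  "primal_objective f p g A x = ereal (f x) + (\<Sum>i = 1..p. g i (transpose (A i) *v x))"

text \<open>
  An optimal solution is a minimiser that is feasible, i.e. has objective value below
  infinity; if the objective is identically infinite there is none.
\<close>

definition optimal_solutions :: "('a \<Rightarrow> ereal) \<Rightarrow> 'a set" where
  "optimal_solutions h = {x. h x < \<infinity> \<and> (\<forall>y. h x \<le> h y)}"

definition pointwise_quadratically_supportable ::
  "('a::real_inner \<Rightarrow> real) \<Rightarrow> ('a \<Rightarrow> 'a) \<Rightarrow> 'a \<Rightarrow> bool" where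
  "pointwise_quadratically_supportable f gradf xh \<longleftrightarrow>
     (\<exists>\<mu> V. \<mu> > 0 \<and> convex V \<and> xh \<in> interior V \<and>
        (\<forall>x\<in>V. f x \<ge> f xh + gradf xh \<bullet> (x - xh) + \<mu> / 2 * (norm (x - xh))\<^sup>2))"

end

theory Submission
  imports Defs
begin

text \<open>
  Write the objective as \<open>f + G\<close> with \<open>G x = (\<Sum>i. g\<^sub>i (A\<^sub>i\<^sup>T x))\<close>. Both summands are
  convex and \<open>f + G\<close> is constant on the convex set of minimisers, so neither summand can
  be strictly below its chord there: \<open>f\<close> is affine on every segment joining two minimisers
  (\<open>convex_combination_of_minimisers\<close>).

  Quadratic support forbids this. Let \<open>z\<close> be the midpoint of two distinct minimisers with
  difference \<open>d\<close>. As \<open>z\<close> is itself a minimiser, \<open>f\<close> is quadratically supported at \<open>z\<close>.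
  Adding the support inequalities at \<open>z + s d\<close> and \<open>z - s d\<close>, for small \<open>s > 0\<close>, cancels
  the linear terms and leaves
  \<open>f (z + s d) + f (z - s d) \<ge> 2 f z + \<mu> s\<^sup>2 \<parallel>d\<parallel>\<^sup>2\<close>, whereas affinity makes the left-hand
  side equal to \<open>2 f z\<close> (\<open>minimiser_unique\<close>).
\<close>

lemma ereal_convex_on_add:
  assumes g: "ereal_convex_on S g" and h: "ereal_convex_on S h"
    and g_fin: "\<And>x. x \<in> S \<Longrightarrow> g x \<noteq> -\<infinity>" and h_fin: "\<And>x. x \<in> S \<Longrightarrow> h x \<noteq> -\<infinity>"
  shows "ereal_convex_on S (\<lambda>x. g x + h x)"
proof -
  \<comment> \<open>Multiplication by \<open>a > 0\<close> can fail to distribute only over \<open>\<infinity> + (-\<infinity>)\<close>, excluded here.\<close>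
  have distrib: "ereal a * (u + v) = ereal a * u + ereal a * v"
    if "0 < a" "u \<noteq> -\<infinity>" "v \<noteq> -\<infinity>" for a u v
    using that by (cases u; cases v) (auto simp: algebra_simps)
  show ?thesis
    unfolding ereal_convex_on_def
  proof (intro conjI ballI allI impI)
    show "convex S" using g by (simp add: ereal_convex_on_def)
    fix y z and t :: real
    assume S: "y \<in> S" "z \<in> S" and t: "0 < t \<and> t < 1"
    let ?w = "(1 - t) *\<^sub>R y + t *\<^sub>R z"
    have "g ?w + h ?w \<le> (ereal (1 - t) * g y + ereal t * g z)
                        + (ereal (1 - t) * h y + ereal t * h z)"
      using g h S t by (intro add_mono) (auto simp: ereal_convex_on_def)
    also have "\<dots> = ereal (1 - t) * (g y + h y) + ereal t * (g z + h z)"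
      using t g_fin h_fin S by (simp add: distrib ac_simps)
    finally show "g ?w + h ?w \<le> ereal (1 - t) * (g y + h y) + ereal t * (g z + h z)" .
  qed
qed

lemma ereal_sum_not_MInf:
  fixes g :: "'i \<Rightarrow> ereal"
  assumes "\<And>i. i \<in> I \<Longrightarrow> g i \<noteq> -\<infinity>"
  shows "(\<Sum>i\<in>I. g i) \<noteq> -\<infinity>"
  using assms by (induction I rule: infinite_finite_induct) auto

lemma ereal_convex_on_sum:
  assumes "finite I" "convex S"
    and "\<And>i. i \<in> I \<Longrightarrow> ereal_convex_on S (g i)"
    and "\<And>i x. i \<in> I \<Longrightarrow> x \<in> S \<Longrightarrow> g i x \<noteq> -\<infinity>"
  shows "ereal_convex_on S (\<lambda>x. \<Sum>i\<in>I. g i x)"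
  using assms(1,3,4)
proof (induction I rule: finite_induct)
  case empty
  then show ?case using assms(2) by (simp add: ereal_convex_on_def)
next
  case (insert i I)
  then show ?case
    by (simp add: ereal_convex_on_add ereal_sum_not_MInf)
qed

lemma ereal_convex_on_linear_compose:
  assumes "ereal_convex_on S g" "linear a" "\<And>x. a x \<in> S"
  shows "ereal_convex_on UNIV (\<lambda>x. g (a x))"
  using assms by (simp add: ereal_convex_on_def linear_add linear_scale)

text \<open>
  Properness and convexity constrain each \<open>g\<^sub>i\<close> only on its own coordinate space, so they
  say something about \<open>g\<^sub>i (A\<^sub>i\<^sup>T x)\<close> only because the padded matrix keeps \<open>A\<^sub>i\<^sup>T x\<close> there.
\<close>

lemma transpose_matrix_on_in_coord_space:
  assumes "matrix_on J A"
  shows "transpose A *v x \<in> coord_space J"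
  using assms by (simp add: matrix_on_def coord_space_def transpose_def matrix_vector_mult_def)

text \<open>
  With \<open>m\<close> the minimal value, \<open>m \<le> f z + G z\<close>, while the convexity bounds on \<open>f z\<close> and
  \<open>G z\<close> add up to exactly \<open>m\<close>. So both bounds are attained; the second conclusion records
  this for \<open>f\<close>, in the direction that convexity alone does not give.
\<close>

lemma convex_combination_of_minimisers:
  fixes f :: "'a::real_vector \<Rightarrow> real"
  assumes f: "convex_on UNIV f" and G: "ereal_convex_on UNIV G"
    and G_fin: "\<And>x. G x \<noteq> -\<infinity>"
    and x: "x \<in> optimal_solutions (\<lambda>x. ereal (f x) + G x)"
    and y: "y \<in> optimal_solutions (\<lambda>x. ereal (f x) + G x)"
    and t: "0 < t" "t < 1"
  defines "z \<equiv> (1 - t) *\<^sub>R x + t *\<^sub>R y"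
  shows "z \<in> optimal_solutions (\<lambda>x. ereal (f x) + G x)"
    and "(1 - t) * f x + t * f y \<le> f z"
proof -
  obtain a where a: "G x = ereal a"
    using x G_fin[of x] by (cases "G x") (auto simp: optimal_solutions_def)
  obtain b where b: "G y = ereal b"
    using y G_fin[of y] by (cases "G y") (auto simp: optimal_solutions_def)
  have x_min: "ereal (f x + a) \<le> ereal (f w) + G w" for w
    using x a by (auto simp: optimal_solutions_def)
  have y_min: "ereal (f y + b) \<le> ereal (f w) + G w" for w
    using y b by (auto simp: optimal_solutions_def)
  have same_value: "f x + a = f y + b"
    using x_min[of y] y_min[of x] a b by simp
  have "G z \<le> ereal (1 - t) * G x + ereal t * G y"
    using G t by (simp add: ereal_convex_on_def z_def)
  then have "G z \<le> ereal ((1 - t) * a + t * b)" by (simp add: a b)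
  then obtain c where c: "G z = ereal c" "c \<le> (1 - t) * a + t * b"
    using G_fin[of z] by (cases "G z") auto
  have fz: "f z \<le> (1 - t) * f x + t * f y"
    using convex_onD[OF f, of t x y] t by (simp add: z_def)
  have z_ge: "f x + a \<le> f z + c" using x_min[of z] c(1) by simp
  have average: "(1 - t) * (f x + a) + t * (f y + b) = f x + a"
    by (subst same_value[symmetric]) (simp only: flip: distrib_right, simp)
  have split: "(1 - t) * (f x + a) + t * (f y + b)
      = ((1 - t) * f x + t * f y) + ((1 - t) * a + t * b)"
    by (simp add: algebra_simps)
  show "(1 - t) * f x + t * f y \<le> f z"
    using z_ge c(2) average split by linarith
  have "f z + c = f x + a"
    using z_ge c(2) average split fz by linarith
  then have "ereal (f z) + G z = ereal (f x + a)" by (simp add: c(1))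
  then show "z \<in> optimal_solutions (\<lambda>x. ereal (f x) + G x)"
    using x_min by (simp add: optimal_solutions_def c(1))
qed

lemma minimiser_unique:
  fixes f :: "'a::real_inner \<Rightarrow> real"
  assumes f: "convex_on UNIV f" and G: "ereal_convex_on UNIV G"
    and G_fin: "\<And>x. G x \<noteq> -\<infinity>"
    and supp: "\<And>x. x \<in> optimal_solutions (\<lambda>x. ereal (f x) + G x) \<Longrightarrow>
                 pointwise_quadratically_supportable f gradf x"
    and x: "x \<in> optimal_solutions (\<lambda>x. ereal (f x) + G x)"
    and y: "y \<in> optimal_solutions (\<lambda>x. ereal (f x) + G x)"
  shows "x = y"
proof (rule ccontr)
  assume "x \<noteq> y"
  note comb = convex_combination_of_minimisers[OF f G G_fin]
  define d where "d = y - x"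
  define w where "w t = (1 - t) *\<^sub>R x + t *\<^sub>R y" for t :: real
  define z where "z = w (1/2)"
  have d: "norm d > 0" using \<open>x \<noteq> y\<close> by (simp add: d_def)
  have w_opt: "w t \<in> optimal_solutions (\<lambda>x. ereal (f x) + G x)" if "0 < t" "t < 1" for t
    unfolding w_def using comb(1)[OF x y that] .
  then have "pointwise_quadratically_supportable f gradf z"
    by (intro supp) (simp add: z_def)
  then obtain \<mu> V where \<mu>: "\<mu> > 0" and V: "z \<in> interior V"
    and quad: "\<And>v. v \<in> V \<Longrightarrow>
      f z + gradf z \<bullet> (v - z) + \<mu> / 2 * (norm (v - z))\<^sup>2 \<le> f v"
    unfolding pointwise_quadratically_supportable_def by blast
  obtain e where e: "e > 0" "ball z e \<subseteq> V"
    using V by (auto simp: mem_interior)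
  \<comment> \<open>Small enough that \<open>z \<plusminus> s d\<close> lie both in the neighbourhood and strictly between \<open>x\<close> and \<open>y\<close>.\<close>
  define s where "s = min (1/4) (e / (2 * norm d))"
  have s: "0 < s" "s < 1/2" using e d by (auto simp: s_def)
  have "s * norm d \<le> e / (2 * norm d) * norm d"
    using d by (intro mult_right_mono) (auto simp: s_def)
  then have near: "s * norm d < e" using e d by simp
  have shift: "w (1/2 + r) = z + r *\<^sub>R d" for r
    by (simp add: w_def z_def d_def algebra_simps)
  have quad_shift: "f z + r * (gradf z \<bullet> d) + \<mu> / 2 * (s * norm d)\<^sup>2 \<le> f (w (1/2 + r))"
    if "\<bar>r\<bar> = s" for r
  proof -
    have "w (1/2 + r) \<in> ball z e" using near that by (simp add: shift dist_norm)
    then have "w (1/2 + r) \<in> V" using e(2) by blast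
    from quad[OF this] show ?thesis by (simp add: shift that)
  qed
  have "f (w (1/2 + s)) + f (w (1/2 - s)) \<ge> 2 * f z + \<mu> * (s * norm d)\<^sup>2"
    using quad_shift[of s] quad_shift[of "- s"] s by simp
  moreover have "\<mu> * (s * norm d)\<^sup>2 > 0" using \<mu> s d by simp
  \<comment> \<open>The points \<open>z \<plusminus> s d\<close> are minimisers themselves, so \<open>f\<close> is affine between them.\<close>
  moreover have "(f (w (1/2 - s)) + f (w (1/2 + s))) / 2 \<le> f z"
  proof -
    have "(1 - 1/2) *\<^sub>R w (1/2 - s) + (1/2) *\<^sub>R w (1/2 + s) = z"
      using shift[of s] shift[of "- s"] scaleR_half_double[of z]
      by (simp flip: scaleR_right_distrib)
    then show ?thesis
      using comb(2)[OF w_opt[of "1/2 - s"] w_opt[of "1/2 + s"], of "1/2"] s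
      by (simp add: add_divide_distrib)
  qed
  ultimately show False by (simp add: field_simps)
qed

theorem corollary3p1:
  fixes f :: "real ^ 'n \<Rightarrow> real"
    and gradf :: "real ^ 'n \<Rightarrow> real ^ 'n"
    and L\<^sub>f :: real
    and p :: nat
    and J :: "nat \<Rightarrow> 'm::finite set"
    and g :: "nat \<Rightarrow> real ^ 'm \<Rightarrow> ereal"
    and A :: "nat \<Rightarrow> real ^ 'm ^ 'n"
    and X :: "(real ^ 'n) set"
  defines "X \<equiv> optimal_solutions (primal_objective f p g A)"
  assumes f_convex: "convex_on UNIV f"
    and f_grad: "\<And>x. GDERIV f x :> gradf x"
    and grad_cont: "continuous_on UNIV gradf"
    and grad_lipschitz: "L\<^sub>f-lipschitz_on UNIV gradf"
    and dims: "\<And>i. i \<in> {1..p} \<Longrightarrow> J i \<noteq> {}"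
    and g_proper: "\<And>i. i \<in> {1..p} \<Longrightarrow> proper_on (coord_space (J i)) (g i)"
    and g_lsc: "\<And>i. i \<in> {1..p} \<Longrightarrow> lsc_on (coord_space (J i)) (g i)"
    and g_convex: "\<And>i. i \<in> {1..p} \<Longrightarrow> ereal_convex_on (coord_space (J i)) (g i)"
    and A_map: "\<And>i. i \<in> {1..p} \<Longrightarrow> matrix_on (J i) (A i)"
    and A_full_rank: "\<And>i. i \<in> {1..p} \<Longrightarrow> lambda_min (J i) (transpose (A i) ** A i) > 0"
    and X_nonempty: "X \<noteq> {}"
    and f_supportable: "\<And>xh. xh \<in> X \<Longrightarrow> pointwise_quadratically_supportable f gradf xh"
  shows "is_singleton X"
proof -
  define G where "G x = (\<Sum>i = 1..p. g i (transpose (A i) *v x))" for x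
  have in_J: "transpose (A i) *v x \<in> coord_space (J i)" if "i \<in> {1..p}" for i x
    using A_map[OF that] by (rule transpose_matrix_on_in_coord_space)
  have g_fin: "g i (transpose (A i) *v x) \<noteq> -\<infinity>" if "i \<in> {1..p}" for i x
    using g_proper[OF that] in_J[OF that] by (auto simp: proper_on_def)
  have G_fin: "G x \<noteq> -\<infinity>" for x
    unfolding G_def by (intro ereal_sum_not_MInf g_fin)
  have G_convex: "ereal_convex_on UNIV G"
    unfolding G_def using g_fin
    by (intro ereal_convex_on_sum ereal_convex_on_linear_compose[OF g_convex]
          matrix_vector_mul_linear in_J) auto
  have X_eq: "X = optimal_solutions (\<lambda>x. ereal (f x) + G x)"
    by (simp add: X_def G_def primal_objective_def[abs_def])
  have "x = y" if "x \<in> X" "y \<in> X" for x y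
    using minimiser_unique[OF f_convex G_convex G_fin f_supportable[unfolded X_eq]] that
    by (simp add: X_eq)
  then show ?thesis using X_nonempty by (blast intro: is_singletonI')
qed

end
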